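(* Let $N\ge1$ and let $x_i,y_i,A_i,B_i$ ($1\le i\le N$) be complex numbers with $A_i,B_i\ne0$. Let $\lambda,\mu$ be strict partitions with $\ell(\lambda)=\ell(\mu)=\ell$. Then $$Z(\mathfrak S_{\lambda/\mu})=\det_{1\le i,j\le\ell}Z(\mathfrak S_{(\lambda_i)/(\mu_j)})\qquad\text{and}\qquad Z(\mathfrak S^*_{\lambda/\mu})=\det_{1\le i,j\le\ell}Z(\mathfrak S^*_{(\lambda_i)/(\mu_j)}),$$ where the numbers of columns of the models are chosen so that, if the models on the left side have $C$ columns and the $(i,j)$ models on the right side have $C_{ij}$ columns, then $C=\sum_{i=1}^\ell C_{i,\sigma(i)}$ for every permutation $\sigma$ of $\{1,\dots,\ell\}$.
   Context: A strict partition is $\lambda=(\lambda_1>\dots>\lambda_\ell\ge0)$, with length $\ell(\lambda)=\ell$; $(\lambda_i)$ denotes the one-part partition. Models. A grid with $N$ rows and $C$ columns labelled $0,\dots,C-1$ from left to right, where $C-1$ is at least every part of the partitions involved. Edges carry spins $\pm$; left and right boundary edges are all $+$. A vertex is written (left, top, right, bottom). $Z$ is the sum over spin assignments to interior edges of the product of vertex weights (non-listed vertices have weight $0$). $\mathfrak S_{\lambda/\mu}$: rows labelled $1,\dots,N$ from bottom to top; bottom boundary $-$ exactly on parts of $\lambda$, top boundary $-$ exactly on parts of $\mu$; weights in row $i$: $(+,+,+,+)\mapsto A_i$, $(-,-,-,-)\mapsto y_iA_iB_i$, $(+,-,+,-)\mapsto A_iB_i$, $(-,+,-,+)\mapsto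 x_iA_i$, $(-,+,+,-)\mapsto(x_i+y_i)A_iB_i$, $(+,-,-,+)\mapsto A_i$. $\mathfrak S^*_{\lambda/\mu}$: rows labelled $1,\dots,N$ from top to bottom; top boundary $-$ exactly on parts of $\lambda$, bottom boundary $-$ exactly on parts of $\mu$; weights in row $i$: $(+,+,+,+)\mapsto A_i^{-1}$, $(-,-,-,-)\mapsto x_iA_i^{-1}B_i^{-1}$, $(+,-,+,-)\mapsto A_i^{-1}B_i^{-1}$, $(-,+,-,+)\mapsto y_iA_i^{-1}$, $(+,+,-,-)\mapsto(x_i+y_i)A_i^{-1}$, $(-,-,+,+)\mapsto A_i^{-1}B_i^{-1}$. All models in each identity use the same $N$ rows and row parameters. *)

theory Defs
  imports Complex_Main "HOL-Library.FuncSet" "HOL-Combinatorics.Permutations"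
    "Jordan_Normal_Form.Determinant"
begin

text \<open>
  A strict partition is the list of its parts; a last part equal to 0 is allowed
  and counts towards the length.
\<close>

definition strict_partition :: "nat list \<Rightarrow> bool" where
  "strict_partition lam \<longleftrightarrow> sorted_wrt (>) lam"

datatype spin = Plus | Minus

text \<open>
  Vertex weights: the four spins are those of the left, top, right and bottom edge,
  in this order.
\<close>

type_synonym vertex_weight = "spin \<Rightarrow> spin \<Rightarrow> spin \<Rightarrow> spin \<Rightarrow> complex"

fun weight_S :: "complex \<Rightarrow> complex \<Rightarrow> complex \<Rightarrow> complex \<Rightarrow> vertex_weight" where
  "weight_S x y A B Plus  Plus  Plus  Plus  = A"
| "weight_S x y A B Minus Minus Minus Minus = y * A * B"
| "weight_S x y A B Plus  Minus Plus  Minus = A * B"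
| "weight_S x y A B Minus Plus  Minus Plus  = x * A"
| "weight_S x y A B Minus Plus  Plus  Minus = (x + y) * A * B"
| "weight_S x y A B Plus  Minus Minus Plus  = A"
| "weight_S x y A B _ _ _ _ = 0"

fun weight_S_star :: "complex \<Rightarrow> complex \<Rightarrow> complex \<Rightarrow> complex \<Rightarrow> vertex_weight" where
  "weight_S_star x y A B Plus  Plus  Plus  Plus  = inverse A"
| "weight_S_star x y A B Minus Minus Minus Minus = x * inverse A * inverse B"
| "weight_S_star x y A B Plus  Minus Plus  Minus = inverse A * inverse B"
| "weight_S_star x y A B Minus Plus  Minus Plus  = y * inverse A"
| "weight_S_star x y A B Plus  Plus  Minus Minus = (x + y) * inverse A"
| "weight_S_star x y A B Minus Minus Plus  Plus  = inverse A * inverse B"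
| "weight_S_star x y A B _ _ _ _ = 0"

text \<open>
  In the grid, \<open>p = 1, \<dots>, N\<close> is the height of a row, counted from the bottom.
  The spin \<open>h (p, c)\<close> sits on the horizontal edge of row \<open>p\<close> to the left of column \<open>c\<close>
  (so \<open>h (p, C)\<close> is the right boundary edge), and \<open>v (p, c)\<close> on the vertical edge of
  column \<open>c\<close> just above row \<open>p\<close> (so \<open>v (0, c)\<close> is the bottom boundary edge).
  The boundary spins being prescribed, a state amounts to a choice of spins on the
  interior edges.
\<close>

definition boundary_spin :: "nat list \<Rightarrow> nat \<Rightarrow> spin" where
  "boundary_spin lam c = (if c \<in> set lam then Minus else Plus)"

definition states ::
  "nat \<Rightarrow> nat \<Rightarrow> nat list \<Rightarrow> nat list \<Rightarrow> ((nat \<times> nat \<Rightarrow> spin) \<times> (nat \<times> nat \<Rightarrow> spin)) set" where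
  "states N C lower upper =
    {(h, v). h \<in> ({1..N} \<times> {0..C}) \<rightarrow>\<^sub>E UNIV \<and> v \<in> ({0..N} \<times> {0..<C}) \<rightarrow>\<^sub>E UNIV \<and>
      (\<forall>p\<in>{1..N}. h (p, 0) = Plus \<and> h (p, C) = Plus) \<and>
      (\<forall>c<C. v (0, c) = boundary_spin lower c \<and> v (N, c) = boundary_spin upper c)}"

definition partition_function ::
  "nat \<Rightarrow> nat \<Rightarrow> (nat \<Rightarrow> vertex_weight) \<Rightarrow> nat list \<Rightarrow> nat list \<Rightarrow> complex" where
  "partition_function N C w lower upper =
    (\<Sum>(h, v)\<in>states N C lower upper.
      \<Prod>p=1..N. \<Prod>c<C. w p (h (p, c)) (v (p, c)) (h (p, Suc c)) (v (p - 1, c)))"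

definition Z_S :: "nat \<Rightarrow> nat \<Rightarrow> (nat \<Rightarrow> complex) \<Rightarrow> (nat \<Rightarrow> complex) \<Rightarrow>
    (nat \<Rightarrow> complex) \<Rightarrow> (nat \<Rightarrow> complex) \<Rightarrow> nat list \<Rightarrow> nat list \<Rightarrow> complex" where
  "Z_S N C x y A B lam mu =
    partition_function N C (\<lambda>p. weight_S (x p) (y p) (A p) (B p)) lam mu"

text \<open>
  In the dual model the rows are labelled from top to bottom, so the row at height \<open>p\<close>
  has label \<open>N + 1 - p\<close>; \<open>lam\<close> is on the top boundary and \<open>mu\<close> on the bottom.
\<close>

definition Z_S_star :: "nat \<Rightarrow> nat \<Rightarrow> (nat \<Rightarrow> complex) \<Rightarrow> (nat \<Rightarrow> complex) \<Rightarrow>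
    (nat \<Rightarrow> complex) \<Rightarrow> (nat \<Rightarrow> complex) \<Rightarrow> nat list \<Rightarrow> nat list \<Rightarrow> complex" where
  "Z_S_star N C x y A B lam mu =
    partition_function N C
      (\<lambda>p. let i = N + 1 - p in weight_S_star (x i) (y i) (A i) (B i)) mu lam"

end

theory Submission
  imports Defs
begin

text \<open>
  Both models are free-fermionic. Reading the \<open>-\<close> spins as paths, the weight of a vertex where two
  paths meet equals (product of the two turns) minus (product of the two straight steps), so the
  partition function of one row is, as in the Lindstroem-Gessel-Viennot lemma, \<open>A ^ C\<close> times the
  determinant of a one-path kernel that does not depend on the number \<open>C\<close> of columns; this goes by
  induction on the columns, expanding along the last one. Cauchy-Binet composes the rows. The
  factors \<open>A ^ C\<close> leave the determinant because the column numbers add up to \<open>C\<close> along each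
  permutation. The dual model is the same row model with top and bottom exchanged.
\<close>

section \<open>Determinants of lists of functions\<close>

text \<open>Rows are functions and columns are points, so one more path is one more list element.
  The value 0 for unequal lengths reflects that the number of paths is conserved; it keeps length
  hypotheses out of the row formula.\<close>

definition list_det :: "('a \<Rightarrow> 'b::comm_ring_1) list \<Rightarrow> 'a list \<Rightarrow> 'b" where
  "list_det fs ms =
    (if length fs = length ms then det (mat (length fs) (length fs) (\<lambda>(i, j). (fs ! i) (ms ! j))) else 0)"

lemma list_det_Nil [simp]: "list_det [] [] = 1"
  by (simp add: list_det_def)

lemma list_det_length: "length fs \<noteq> length ms \<Longrightarrow> list_det fs ms = 0"
  by (simp add: list_det_def)

lemma list_det_singleton: "list_det [f] [m] = f m"
  by (simp add: list_det_def det_single)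

lemma list_det_leibniz:
  "length fs = n \<Longrightarrow> length ms = n \<Longrightarrow>
    list_det fs ms = (\<Sum>p | p permutes {0..<n}. signof p * (\<Prod>i = 0..<n. (fs ! i) (ms ! p i)))"
  unfolding list_det_def
  by (auto simp: det_def intro!: sum.cong prod.cong dest: permutes_in_image)

lemma list_det_cong:
  assumes "length fs = length gs"
    and "\<And>i m. i < length fs \<Longrightarrow> m \<in> set ms \<Longrightarrow> (fs ! i) m = (gs ! i) m"
  shows "list_det fs ms = list_det gs ms"
proof -
  have "mat (length fs) (length fs) (\<lambda>(i, j). (fs ! i) (ms ! j)) =
      mat (length fs) (length fs) (\<lambda>(i, j). (gs ! i) (ms ! j))" if "length fs = length ms"
    using assms(2) that by (intro cong_mat) auto
  then show ?thesis
    using assms(1) by (simp add: list_det_def)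
qed

lemma list_det_cong_hd:
  assumes "\<And>m. m \<in> set ms \<Longrightarrow> f m = g m"
  shows "list_det (f # fs) ms = list_det (g # fs) ms"
  using assms by (intro list_det_cong) (auto simp: nth_Cons split: nat.split)

lemma list_det_smult:
  "list_det (gs @ (\<lambda>m. a * f m) # fs) ms = a * list_det (gs @ f # fs) ms"
proof (cases "length gs + Suc (length fs) = length ms")
  case True
  let ?M = "mat (length ms) (length ms) (\<lambda>(i, j). ((gs @ f # fs) ! i) (ms ! j))"
  have "mat (length ms) (length ms) (\<lambda>(i, j). ((gs @ (\<lambda>m. a * f m) # fs) ! i) (ms ! j)) =
      multrow (length gs) a ?M"
    by (intro eq_matI) (auto simp: nth_append nth_Cons')
  moreover have "det (multrow (length gs) a ?M) = a * det ?M"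
    using True by (intro det_multrow[of _ "length ms"]) auto
  ultimately show ?thesis
    using True by (simp add: list_det_def)
qed (simp add: list_det_def)

lemmas list_det_smult_hd = list_det_smult[of "[]", simplified]

lemma list_det_proportional_rows: "list_det (f # (\<lambda>m. a * f m) # fs) ms = 0"
proof -
  have "list_det (f # f # fs) ms = 0"
  proof (cases "length ms = Suc (Suc (length fs))")
    case True
    then show ?thesis
      by (auto simp: list_det_def intro!: det_identical_rows[of _ "length ms" 0 1] eq_vecI)
  qed (simp add: list_det_def)
  then show ?thesis
    using list_det_smult[of "[f]"] by simp
qed

lemma list_det_laplace:
  assumes "length fs = Suc (length ms)"
  shows "list_det fs (m # ms) =
    (\<Sum>i<length fs. (-1) ^ i * (fs ! i) m * list_det (take i fs @ drop (Suc i) fs) ms)"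
proof -
  let ?n = "length fs"
  let ?M = "mat ?n ?n (\<lambda>(i, j). (fs ! i) ((m # ms) ! j))"
  have "det ?M = (\<Sum>i<?n. ?M $$ (i, 0) * cofactor ?M i 0)"
    using assms by (intro laplace_expansion_column) auto
  also have "\<dots> = (\<Sum>i<?n. (-1) ^ i * (fs ! i) m * list_det (take i fs @ drop (Suc i) fs) ms)"
  proof (intro sum.cong refl)
    fix i assume i: "i \<in> {..<?n}"
    have "mat_delete ?M i 0 = mat (length ms) (length ms) (\<lambda>(k, j). ((take i fs @ drop (Suc i) fs) ! k) (ms ! j))"
      using i assms by (intro eq_matI) (auto simp: mat_delete_def nth_append min_def)
    then show "?M $$ (i, 0) * cofactor ?M i 0 =
        (-1) ^ i * (fs ! i) m * list_det (take i fs @ drop (Suc i) fs) ms"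
      using i assms by (auto simp: cofactor_def list_det_def min_def)
  qed
  finally show ?thesis
    using assms by (simp add: list_det_def)
qed

text \<open>Only the first row can be nonzero in the first column, so a single term of the Laplace
  expansion survives.\<close>

lemma list_det_Cons_Cons:
  assumes "\<And>h. h \<in> set fs \<Longrightarrow> h m = 0"
  shows "list_det (f # fs) (m # ms) = f m * list_det fs ms"
proof (cases "length fs = length ms")
  case True
  have "(\<Sum>i<length fs. (-1) ^ Suc i * (fs ! i) m * list_det (f # (take i fs @ drop (Suc i) fs)) ms) = 0"
    using assms[OF nth_mem] by (intro sum.neutral) simp
  then show ?thesis
    using True by (simp add: list_det_laplace sum.lessThan_Suc_shift del: sum.lessThan_Suc)
qed (simp add: list_det_def)

lemma list_det_zero_col:
  assumes "\<And>h. h \<in> set fs \<Longrightarrow> h m = 0"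
  shows "list_det fs (m # ms) = 0"
proof (cases fs)
  case Nil
  then show ?thesis by (simp add: list_det_length)
next
  case (Cons f fs')
  have "list_det (f # fs') (m # ms) = f m * list_det fs' ms"
    using assms Cons by (intro list_det_Cons_Cons) simp
  moreover have "f m = 0"
    using assms Cons by simp
  ultimately show ?thesis
    using Cons by simp
qed

text \<open>Two rows may meet the first column, which leaves two Laplace terms of opposite sign.
  This difference later produces the vertex weight \<open>u * w - h\<close>.\<close>

lemma list_det_Cons_Cons2:
  assumes "\<And>h. h \<in> set fs \<Longrightarrow> h m = 0"
  shows "list_det (f # g # fs) (m # ms) = f m * list_det (g # fs) ms - g m * list_det (f # fs) ms"
proof (cases "length ms = Suc (length fs)")
  case True
  have "(\<Sum>i<length fs. (-1) ^ Suc (Suc i) * (fs ! i) m *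
      list_det (f # g # (take i fs @ drop (Suc i) fs)) ms) = 0"
    using assms[OF nth_mem] by (intro sum.neutral) simp
  then show ?thesis
    using True by (simp add: list_det_laplace sum.lessThan_Suc_shift del: sum.lessThan_Suc)
qed (simp add: list_det_def)

text \<open>Used for the dual model, where the row kernel starts from the top boundary while rows
  are composed from the bottom.\<close>

lemma list_det_transpose:
  fixes k :: "'a \<Rightarrow> 'a \<Rightarrow> 'b::comm_ring_1"
  shows "list_det (map k ls) ms = list_det (map (\<lambda>m l. k l m) ms) ls"
proof (cases "length ls = length ms")
  case True
  let ?M = "mat (length ls) (length ls) (\<lambda>(i, j). k (ls ! i) (ms ! j))"
  have "det (transpose_mat ?M) = det ?M"
    by (rule det_transpose[of _ "length ls"]) simp
  moreover have "transpose_mat ?M = mat (length ls) (length ls) (\<lambda>(i, j). ((map (\<lambda>m l. k l m) ms) ! i) (ls ! j))"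
    using True by (intro eq_matI) auto
  moreover have "?M = mat (length ls) (length ls) (\<lambda>(i, j). ((map k ls) ! i) (ms ! j))"
    by (intro eq_matI) auto
  ultimately show ?thesis
    using True by (simp add: list_det_def)
qed (simp add: list_det_def)

section \<open>Sets of columns as strict partitions, and the Cauchy-Binet formula\<close>

definition desc_list :: "nat set \<Rightarrow> nat list" where
  "desc_list S = rev (sorted_list_of_set S)"

lemma length_desc_list [simp]: "length (desc_list S) = card S"
  by (simp add: desc_list_def)

lemma set_desc_list [simp]: "finite S \<Longrightarrow> set (desc_list S) = S"
  by (simp add: desc_list_def)

lemma distinct_desc_list [simp]: "distinct (desc_list S)"
  by (simp add: desc_list_def)

lemma strict_partition_desc_list [simp]: "strict_partition (desc_list S)"
  by (simp add: desc_list_def strict_partition_def sorted_wrt_rev)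

text \<open>An injective map between finite sets of equal size is a bijection, hence a rearrangement
  of \<open>xs\<close>. This turns a sum over maps with a fixed image into a Leibniz sum.\<close>

lemma bij_betw_permutes_injective:
  assumes "distinct xs"
  shows "bij_betw (\<lambda>p. restrict (\<lambda>i. xs ! p i) {0..<length xs}) {p. p permutes {0..<length xs}}
    {\<phi> \<in> {0..<length xs} \<rightarrow>\<^sub>E set xs. inj_on \<phi> {0..<length xs}}"
    (is "bij_betw ?F ?P ?I")
proof (rule bij_betwI')
  let ?n = "length xs"
  fix p q assume p: "p \<in> ?P" and q: "q \<in> ?P"
  show "(?F p = ?F q) = (p = q)"
  proof
    assume eq: "?F p = ?F q"
    show "p = q"
    proof
      fix i
      show "p i = q i"
      proof (cases "i < ?n")
        case True
        then have "p i < ?n" "q i < ?n"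
          using p q permutes_in_image[of _ "{0..<?n}" i] by auto
        moreover have "xs ! p i = xs ! q i"
          using True fun_cong[OF eq, of i] by simp
        ultimately show ?thesis
          using assms by (simp add: nth_eq_iff_index_eq)
      next
        case False
        then show ?thesis
          using p q by (simp add: permutes_not_in)
      qed
    qed
  qed simp
next
  let ?n = "length xs"
  fix p assume "p \<in> ?P"
  then have p: "p permutes {0..<?n}" by simp
  then have lt: "p i < ?n" if "i < ?n" for i
    using that permutes_in_image[OF p, of i] by simp
  then show "?F p \<in> ?I"
    using assms permutes_inj_on[OF p, of "{0..<?n}"]
    by (auto simp: inj_on_def nth_eq_iff_index_eq)
next
  let ?n = "length xs"
  fix \<phi> assume \<phi>: "\<phi> \<in> ?I"
  have nth: "bij_betw ((!) xs) {0..<?n} (set xs)"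
    using bij_betw_nth[OF assms, of "{..<?n}" "set xs"] by (simp add: lessThan_atLeast0)
  \<comment> \<open>\<open>\<phi>\<close> is pulled back along the indexing of \<open>xs\<close>;
    being the identity outside the range is what \<open>permutes\<close> requires.\<close>
  define p where "p = (\<lambda>i. if i < ?n then inv_into {0..<?n} ((!) xs) (\<phi> i) else i)"
  have p: "p i < ?n \<and> xs ! p i = \<phi> i" if "i < ?n" for i
  proof -
    have "\<phi> i \<in> (!) xs ` {0..<?n}"
      using \<phi> that nth by (auto simp: bij_betw_def)
    then show ?thesis
      using that inv_into_into[of "\<phi> i" "(!) xs" "{0..<?n}"] f_inv_into_f[of "\<phi> i" "(!) xs" "{0..<?n}"]
      by (simp add: p_def)
  qed
  have "inj_on p {0..<?n}"
  proof (rule inj_onI)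
    fix i j assume "i \<in> {0..<?n}" "j \<in> {0..<?n}" "p i = p j"
    then have "\<phi> i = \<phi> j"
      using p[of i] p[of j] by simp
    then show "i = j"
      using \<phi> \<open>i \<in> _\<close> \<open>j \<in> _\<close> by (intro inj_onD[of \<phi> "{0..<?n}" i j]) simp_all
  qed
  moreover have "p ` {0..<?n} \<subseteq> {0..<?n}"
    using p by auto
  ultimately have "bij_betw p {0..<?n} {0..<?n}"
    by (simp add: bij_betw_def endo_inj_surj)
  then have "p permutes {0..<?n}"
    by (rule bij_imp_permutes) (simp add: p_def)
  moreover have "\<phi> = ?F p"
    using \<phi> p by (auto simp: fun_eq_iff PiE_def extensional_def restrict_def)
  ultimately show "\<exists>p\<in>?P. \<phi> = ?F p"
    by blast
qed

text \<open>Multiplying out the determinant on the right gives a sum over all maps from row indices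
  to intermediate points. Maps with a repeated value vanish by equal rows; the others are grouped by
  their image \<open>S\<close>, and each group gives a product of two determinants.\<close>

lemma cauchy_binet:
  fixes fs :: "(nat \<Rightarrow> 'b::comm_ring_1) list" and g :: "nat \<Rightarrow> 'a \<Rightarrow> 'b"
  shows "(\<Sum>S\<in>Pow {..<C}. list_det fs (desc_list S) * list_det (map g (desc_list S)) ms) =
    list_det (map (\<lambda>f m. \<Sum>n<C. f n * g n m) fs) ms"
proof (cases "length fs = length ms")
  case False
  \<comment> \<open>\<open>S\<close> cannot have both cardinalities, so one factor is 0.\<close>
  have "list_det fs (desc_list S) * list_det (map g (desc_list S)) ms = 0" for S
    using False by (cases "card S = length fs") (simp_all add: list_det_length)
  then show ?thesis
    using False by (simp add: list_det_length)
next
  case True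
  define n where "n = length fs"
  have len: "length fs = n" "length ms = n"
    using True by (auto simp: n_def)
  \<comment> \<open>For a choice \<open>\<phi>\<close> of intermediate points,
    \<open>F \<phi>\<close> collects the entries of \<open>fs\<close>, and \<open>G \<phi>\<close>
    is the determinant with rows \<open>g (\<phi> i)\<close>.\<close>
  define G where "G \<phi> = list_det (map (\<lambda>i. g (\<phi> i)) [0..<n]) ms" for \<phi>
  define F where "F \<phi> = (\<Prod>i = 0..<n. (fs ! i) (\<phi> i))" for \<phi>
  have G: "G \<phi> = (\<Sum>p | p permutes {0..<n}. signof p * (\<Prod>i = 0..<n. g (\<phi> i) (ms ! p i)))" for \<phi>
    unfolding G_def by (subst list_det_leibniz[of _ n]) (auto simp: len)
  have sub: "(\<Sum>\<phi> | \<phi> \<in> {0..<n} \<rightarrow>\<^sub>E S \<and> inj_on \<phi> {0..<n}. F \<phi> * G \<phi>) =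
      list_det fs (desc_list S) * list_det (map g (desc_list S)) ms"
    if S: "finite S" "card S = n" for S
  proof -
    let ?e = "desc_list S"
    \<comment> \<open>Listing \<open>S\<close> in another order permutes the rows and costs only a
      sign, which becomes the Leibniz sign of the determinant of \<open>fs\<close>.\<close>
    have Gp: "G (restrict (\<lambda>i. ?e ! p i) {0..<n}) = signof p * list_det (map g ?e) ms"
      if p: "p permutes {0..<n}" for p
    proof -
      let ?M = "mat n n (\<lambda>(i, j). g (?e ! i) (ms ! j))"
      have "det (mat n n (\<lambda>(i, j). ?M $$ (p i, j))) = signof p * det ?M"
        by (rule det_permute_rows[OF _ p]) simp
      moreover have "mat n n (\<lambda>(i, j). ?M $$ (p i, j)) = mat n n (\<lambda>(i, j). g (?e ! p i) (ms ! j))"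
        using permutes_in_image[OF p] by (intro cong_mat) auto
      moreover have "mat n n (\<lambda>(i, j). (map (\<lambda>i. g (restrict (\<lambda>i. ?e ! p i) {0..<n} i)) [0..<n] ! i) (ms ! j)) =
          mat n n (\<lambda>(i, j). g (?e ! p i) (ms ! j))"
        by (intro cong_mat) auto
      moreover have "mat n n (\<lambda>(i, j). (map g ?e ! i) (ms ! j)) = ?M"
        using S by (intro cong_mat) auto
      ultimately show ?thesis
        using S len by (simp add: G_def list_det_def)
    qed
    have "(\<Sum>\<phi> | \<phi> \<in> {0..<n} \<rightarrow>\<^sub>E S \<and> inj_on \<phi> {0..<n}. F \<phi> * G \<phi>) =
        (\<Sum>p | p permutes {0..<n}. F (restrict (\<lambda>i. ?e ! p i) {0..<n}) * G (restrict (\<lambda>i. ?e ! p i) {0..<n}))"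
      using sum.reindex_bij_betw[OF bij_betw_permutes_injective[of ?e], of "\<lambda>\<phi>. F \<phi> * G \<phi>"] S
      by simp
    also have "\<dots> = (\<Sum>p | p permutes {0..<n}. signof p * (\<Prod>i = 0..<n. (fs ! i) (?e ! p i))) * list_det (map g ?e) ms"
      unfolding sum_distrib_right by (intro sum.cong refl) (simp add: Gp F_def)
    also have "\<dots> = list_det fs ?e * list_det (map g ?e) ms"
      using S by (simp add: list_det_leibniz[OF len(1)])
    finally show ?thesis .
  qed
  have "list_det (map (\<lambda>f m. \<Sum>k<C. f k * g k m) fs) ms =
      (\<Sum>p | p permutes {0..<n}. signof p * (\<Prod>i = 0..<n. \<Sum>k<C. (fs ! i) k * g k (ms ! p i)))"
    by (subst list_det_leibniz[of _ n]) (auto simp: len)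
  also have "\<dots> = (\<Sum>p | p permutes {0..<n}. \<Sum>\<phi>\<in>{0..<n} \<rightarrow>\<^sub>E {..<C}.
      signof p * (\<Prod>i = 0..<n. (fs ! i) (\<phi> i) * g (\<phi> i) (ms ! p i)))"
    by (subst prod_sum_PiE) (auto simp: sum_distrib_left)
  also have "\<dots> = (\<Sum>\<phi>\<in>{0..<n} \<rightarrow>\<^sub>E {..<C}. F \<phi> * G \<phi>)"
    unfolding G F_def sum_distrib_left
    by (subst sum.swap) (simp add: prod.distrib mult_ac)
  also have "\<dots> = (\<Sum>\<phi> | \<phi> \<in> {0..<n} \<rightarrow>\<^sub>E {..<C} \<and> inj_on \<phi> {0..<n}. F \<phi> * G \<phi>)"
  proof (rule sum.mono_neutral_right)
    have "G \<phi> = 0" if not_inj: "\<not> inj_on \<phi> {0..<n}" for \<phi>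
    proof -
      obtain i j where "i < n" "j < n" "i \<noteq> j" "\<phi> i = \<phi> j"
        using not_inj unfolding inj_on_def by (metis atLeastLessThan_iff)
      then have "det (mat n n (\<lambda>(i, j). g (\<phi> i) (ms ! j))) = 0"
        by (intro det_identical_rows[of _ n i j] eq_vecI) simp_all
      moreover have "mat n n (\<lambda>(i, j). (map (\<lambda>i. g (\<phi> i)) [0..<n] ! i) (ms ! j)) =
          mat n n (\<lambda>(i, j). g (\<phi> i) (ms ! j))"
        by (intro cong_mat) auto
      ultimately show ?thesis
        using len by (simp add: G_def list_det_def)
    qed
    then show "\<forall>\<phi>\<in>({0..<n} \<rightarrow>\<^sub>E {..<C}) - {\<phi>. \<phi> \<in> {0..<n} \<rightarrow>\<^sub>E {..<C} \<and> inj_on \<phi> {0..<n}}. F \<phi> * G \<phi> = 0"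
      by auto
  qed (auto intro!: finite_PiE)
  also have "\<dots> = (\<Sum>S | S \<subseteq> {..<C} \<and> card S = n.
      \<Sum>\<phi> | \<phi> \<in> {\<phi>. \<phi> \<in> {0..<n} \<rightarrow>\<^sub>E {..<C} \<and> inj_on \<phi> {0..<n}} \<and> \<phi> ` {0..<n} = S. F \<phi> * G \<phi>)"
  proof (rule sum.group[symmetric])
    show "finite {\<phi>. \<phi> \<in> {0..<n} \<rightarrow>\<^sub>E {..<C} \<and> inj_on \<phi> {0..<n}}"
      by (rule finite_subset[of _ "{0..<n} \<rightarrow>\<^sub>E {..<C}"]) (auto intro!: finite_PiE)
    show "finite {S. S \<subseteq> {..<C} \<and> card S = n}"
      by (rule finite_subset[of _ "Pow {..<C}"]) auto
  qed (auto simp: card_image)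
  also have "\<dots> = (\<Sum>S | S \<subseteq> {..<C} \<and> card S = n. list_det fs (desc_list S) * list_det (map g (desc_list S)) ms)"
  proof (intro sum.cong refl)
    fix S assume "S \<in> {S. S \<subseteq> {..<C} \<and> card S = n}"
    then have S: "S \<subseteq> {..<C}" "card S = n" "finite S"
      by (auto intro: finite_subset)
    have "{\<phi> \<in> {\<phi>. \<phi> \<in> {0..<n} \<rightarrow>\<^sub>E {..<C} \<and> inj_on \<phi> {0..<n}}. \<phi> ` {0..<n} = S} =
        {\<phi>. \<phi> \<in> {0..<n} \<rightarrow>\<^sub>E S \<and> inj_on \<phi> {0..<n}}"
    proof -
      have "\<phi> ` {0..<n} = S" if "\<phi> \<in> {0..<n} \<rightarrow>\<^sub>E S" "inj_on \<phi> {0..<n}" for \<phi>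
        using that S by (intro card_subset_eq) (auto simp: card_image)
      then show ?thesis
        using S by (auto simp: PiE_iff)
    qed
    then show "(\<Sum>\<phi> | \<phi> \<in> {\<phi>. \<phi> \<in> {0..<n} \<rightarrow>\<^sub>E {..<C} \<and> inj_on \<phi> {0..<n}} \<and> \<phi> ` {0..<n} = S. F \<phi> * G \<phi>) =
        list_det fs (desc_list S) * list_det (map g (desc_list S)) ms"
      using sub[OF S(3,2)] by simp
  qed
  also have "\<dots> = (\<Sum>S\<in>Pow {..<C}. list_det fs (desc_list S) * list_det (map g (desc_list S)) ms)"
    by (rule sum.mono_neutral_left) (auto simp: list_det_length len)
  finally show ?thesis ..
qed

section \<open>Row by row decomposition\<close>

text \<open>
  \<open>row_sum W b t c a\<close> is the partition function of the leftmost \<open>c\<close> columns of a row with bottom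
  spins \<open>b\<close> and top spins \<open>t\<close>, when the spin to the right of these columns is \<open>a\<close>.
\<close>

fun row_sum :: "vertex_weight \<Rightarrow> (nat \<Rightarrow> spin) \<Rightarrow> (nat \<Rightarrow> spin) \<Rightarrow> nat \<Rightarrow> spin \<Rightarrow> complex" where
  "row_sum W b t 0 a = (if a = Plus then 1 else 0)"
| "row_sum W b t (Suc c) a =
    row_sum W b t c Plus * W Plus (t c) a (b c) + row_sum W b t c Minus * W Minus (t c) a (b c)"

lemma UNIV_spin: "UNIV = {Plus, Minus}"
  using spin.exhaust by auto

lemma finite_UNIV_spin [simp]: "finite (UNIV :: spin set)"
  by (simp add: UNIV_spin)

lemma row_sum_cong:
  assumes "\<And>d. d < c \<Longrightarrow> b d = b' d" "\<And>d. d < c \<Longrightarrow> t d = t' d"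
  shows "row_sum W b t c a = row_sum W b' t' c a"
  using assms by (induction c arbitrary: a) auto

lemma row_sum_flip: "row_sum (\<lambda>l t r b. W l b r t) b t c a = row_sum W t b c a"
  by (induction c arbitrary: a) auto

lemma row_sum_eq_sum_PiE:
  "row_sum W b t C a =
    (\<Sum>g | g \<in> {0..C} \<rightarrow>\<^sub>E UNIV \<and> g 0 = Plus \<and> g C = a. \<Prod>c<C. W (g c) (t c) (g (Suc c)) (b c))"
proof (induction C arbitrary: a)
  case 0
  have "{g. g \<in> {0..0} \<rightarrow>\<^sub>E UNIV \<and> g 0 = Plus \<and> g 0 = a} =
      (if a = Plus then {\<lambda>i\<in>{0::nat}. Plus} else {})"
    by (auto simp: PiE_iff extensional_def fun_eq_iff)
  then show ?case
    by simp
next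
  case (Suc C)
  let ?R = "\<lambda>C a. {g. g \<in> {0..C} \<rightarrow>\<^sub>E UNIV \<and> g 0 = Plus \<and> g C = a}"
  have fin: "finite (?R C a)" for a
    by (rule finite_subset[of _ "{0..C} \<rightarrow>\<^sub>E UNIV"]) (auto intro!: finite_PiE)
  have "row_sum W b t (Suc C) a =
      (\<Sum>e\<in>UNIV. \<Sum>g\<in>?R C e. (\<Prod>c<C. W (g c) (t c) (g (Suc c)) (b c)) * W e (t C) a (b C))"
    by (simp add: Suc UNIV_spin sum_distrib_right)
  also have "\<dots> = (\<Sum>(e, g)\<in>Sigma UNIV (?R C).
      (\<Prod>c<C. W (g c) (t c) (g (Suc c)) (b c)) * W e (t C) a (b C))"
    using fin by (subst sum.Sigma) (auto simp: UNIV_spin)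
  also have "\<dots> = (\<Sum>g\<in>?R (Suc C) a. \<Prod>c<Suc C. W (g c) (t c) (g (Suc c)) (b c))"
    \<comment> \<open>A pair records the spin \<open>e\<close> on edge \<open>C\<close> and a spin
      sequence ending in it; appending \<open>a\<close> at \<open>Suc C\<close> gives the longer
      sequence.\<close>
    by (rule sum.reindex_bij_witness[where j = "\<lambda>(e, g). g(Suc C := a)"
          and i = "\<lambda>g. (g C, restrict g {0..C})"])
      (auto simp: PiE_iff extensional_def fun_eq_iff restrict_def)
  finally show ?case .
qed

lemma finite_states [simp]: "finite (states N C lower upper)"
  by (rule finite_subset[of _ "(({1..N} \<times> {0..C}) \<rightarrow>\<^sub>E UNIV) \<times> (({0..N} \<times> {0..<C}) \<rightarrow>\<^sub>E UNIV)"])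
    (auto simp: states_def intro!: finite_PiE)

lemma boundary_spin_desc_list:
  "finite S \<Longrightarrow> boundary_spin (desc_list S) c = (if c \<in> S then Minus else Plus)"
  by (simp add: boundary_spin_def)

text \<open>The grid is cut below its top row, and \<open>S\<close> is the set of columns with
  \<open>Minus\<close> on the cut. A state splits uniquely into \<open>S\<close>, a state of the
  lower \<open>N\<close> rows with top boundary \<open>S\<close>, and the horizontal spins of row
  \<open>Suc N\<close>.\<close>

lemma partition_function_Suc:
  "partition_function (Suc N) C W lower upper =
    (\<Sum>S\<in>Pow {..<C}. partition_function N C W lower (desc_list S) *
      row_sum (W (Suc N)) (boundary_spin (desc_list S)) (boundary_spin upper) C Plus)"
proof -
  let ?G = "{g. g \<in> {0..C} \<rightarrow>\<^sub>E UNIV \<and> g 0 = Plus \<and> g C = Plus}"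
  let ?pr = "\<lambda>N (h, v). \<Prod>p=1..N. \<Prod>c<C. W p (h (p, c)) (v (p, c)) (h (p, Suc c)) (v (p - 1, c))"
  let ?row = "\<lambda>S g. \<Prod>c<C. W (Suc N) (g c) (boundary_spin upper c) (g (Suc c)) (boundary_spin (desc_list S) c)"
  \<comment> \<open>The top boundary spins, absent from the lower state, are filled in from
    \<open>upper\<close>. Outside the ranges all pieces are \<open>undefined\<close>, so the glued
    functions stay extensional.\<close>
  let ?join = "\<lambda>(S, (h, v), g). ((\<lambda>(p, c). if p = Suc N then g c else h (p, c)),
      (\<lambda>(p, c). if p = Suc N \<and> c < C then boundary_spin upper c else v (p, c)))"
  let ?split = "\<lambda>(h, v). ({c. c < C \<and> v (N, c) = Minus},
      (restrict h ({1..N} \<times> {0..C}), restrict v ({0..N} \<times> {0..<C})), \<lambda>c\<in>{0..C}. h (Suc N, c))"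
  have finG: "finite ?G"
    by (rule finite_subset[of _ "{0..C} \<rightarrow>\<^sub>E UNIV"]) (auto intro!: finite_PiE)
  have "(\<Sum>S\<in>Pow {..<C}. partition_function N C W lower (desc_list S) *
      row_sum (W (Suc N)) (boundary_spin (desc_list S)) (boundary_spin upper) C Plus) =
    (\<Sum>S\<in>Pow {..<C}. \<Sum>(hv, g)\<in>states N C lower (desc_list S) \<times> ?G. ?pr N hv * ?row S g)"
    unfolding partition_function_def row_sum_eq_sum_PiE
    by (intro sum.cong refl) (simp add: sum_product sum.cartesian_product split_def)
  also have "\<dots> = (\<Sum>(S, hv, g)\<in>(SIGMA S:Pow {..<C}. states N C lower (desc_list S) \<times> ?G). ?pr N hv * ?row S g)"
    by (subst sum.Sigma) (use finG in \<open>auto simp: split_def\<close>)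
  also have "\<dots> = (\<Sum>hv\<in>states (Suc N) C lower upper. ?pr (Suc N) hv)"
  proof (rule sum.reindex_bij_witness[where j = ?join and i = ?split])
    fix a assume a: "a \<in> (SIGMA S:Pow {..<C}. states N C lower (desc_list S) \<times> ?G)"
    obtain S h v g where [simp]: "a = (S, (h, v), g)"
      by (metis surj_pair)
    have S: "S \<subseteq> {..<C}" "finite S"
      and hv: "(h, v) \<in> states N C lower (desc_list S)" and g: "g \<in> ?G"
      using a by (auto intro: finite_subset)
    have vN: "v (N, c) = (if c \<in> S then Minus else Plus)" if "c < C" for c
      using hv S that by (auto simp: states_def boundary_spin_desc_list)
    have v_ext: "v (p, c) = undefined" if "\<not> (p \<le> N \<and> c < C)" for p c
      using hv that by (auto simp: states_def PiE_iff extensional_def)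
    have h_ext: "h (p, c) = undefined" if "\<not> (1 \<le> p \<and> p \<le> N \<and> c \<le> C)" for p c
      using hv that by (auto simp: states_def PiE_iff extensional_def)
    have g_ext: "g c = undefined" if "\<not> c \<le> C" for c
      using g that by (auto simp: PiE_iff extensional_def)
    define h' where "h' = (\<lambda>(p, c). if p = Suc N then g c else h (p, c))"
    define v' where "v' = (\<lambda>(p, c). if p = Suc N \<and> c < C then boundary_spin upper c else v (p, c))"
    have join: "?join a = (h', v')"
      by (simp add: h'_def v'_def)
    have top: "h' (Suc N, c) = g c" "c < C \<Longrightarrow> v' (Suc N, c) = boundary_spin upper c" for c
      by (simp_all add: h'_def v'_def)
    have low: "p \<le> N \<Longrightarrow> h' (p, c) = h (p, c)" "p \<le> N \<Longrightarrow> v' (p, c) = v (p, c)" for p c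
      by (simp_all add: h'_def v'_def)
    show "?join a \<in> states (Suc N) C lower upper"
      using hv g by (auto simp: states_def PiE_iff extensional_def)
    have S_eq: "{c. c < C \<and> v' (N, c) = Minus} = S"
      using vN S by (auto simp: low split: if_splits)
    have "restrict h' ({1..N} \<times> {0..C}) = h"
    proof
      fix pc show "restrict h' ({1..N} \<times> {0..C}) pc = h pc"
        using h_ext[of "fst pc" "snd pc"] by (cases pc) (auto simp: restrict_def low)
    qed
    moreover have "restrict v' ({0..N} \<times> {0..<C}) = v"
    proof
      fix pc show "restrict v' ({0..N} \<times> {0..<C}) pc = v pc"
        using v_ext[of "fst pc" "snd pc"] by (cases pc) (auto simp: restrict_def low)
    qed
    moreover have "(\<lambda>c\<in>{0..C}. h' (Suc N, c)) = g"
    proof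
      fix c show "(\<lambda>c\<in>{0..C}. h' (Suc N, c)) c = g c"
        using g_ext[of c] by (simp add: restrict_def top)
    qed
    ultimately show "?split (?join a) = a"
      unfolding join using S_eq by simp
    have "?pr (Suc N) (h', v') = (\<Prod>p=1..N. \<Prod>c<C. W p (h' (p, c)) (v' (p, c)) (h' (p, Suc c)) (v' (p - 1, c))) *
        (\<Prod>c<C. W (Suc N) (h' (Suc N, c)) (v' (Suc N, c)) (h' (Suc N, Suc c)) (v' (N, c)))"
      by simp
    also have "(\<Prod>p=1..N. \<Prod>c<C. W p (h' (p, c)) (v' (p, c)) (h' (p, Suc c)) (v' (p - 1, c))) = ?pr N (h, v)"
      unfolding prod.case by (intro prod.cong refl) (simp add: low le_diff_conv)
    also have "(\<Prod>c<C. W (Suc N) (h' (Suc N, c)) (v' (Suc N, c)) (h' (Suc N, Suc c)) (v' (N, c))) = ?row S g"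
      using S by (intro prod.cong refl) (simp add: top low vN boundary_spin_desc_list)
    finally show "?pr (Suc N) (?join a) = (case a of (S, hv, g) \<Rightarrow> ?pr N hv * ?row S g)"
      unfolding join by simp
  next
    fix a assume a: "a \<in> states (Suc N) C lower upper"
    obtain h v where a_eq [simp]: "a = (h, v)"
      by (metis surj_pair)
    have v_top: "v (Suc N, c) = boundary_spin upper c" if "c < C" for c
      using a that by (simp add: states_def)
    have v_ext: "v (p, c) = undefined" if "\<not> (p \<le> Suc N \<and> c < C)" for p c
      using a that by (auto simp: states_def PiE_iff extensional_def)
    have h_ext: "h (p, c) = undefined" if "\<not> (1 \<le> p \<and> p \<le> Suc N \<and> c \<le> C)" for p c
      using a that by (auto simp: states_def PiE_iff extensional_def)
    have "(\<lambda>(p, c). if p = Suc N then (\<lambda>c\<in>{0..C}. h (Suc N, c)) c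
        else restrict h ({1..N} \<times> {0..C}) (p, c)) = h" (is "?h = h")
    proof
      fix pc show "?h pc = h pc"
        using h_ext[of "fst pc" "snd pc"] by (cases pc) (auto simp: restrict_def)
    qed
    moreover have "(\<lambda>(p, c). if p = Suc N \<and> c < C then boundary_spin upper c
        else restrict v ({0..N} \<times> {0..<C}) (p, c)) = v" (is "?v = v")
    proof
      fix pc show "?v pc = v pc"
        using v_ext[of "fst pc" "snd pc"] v_top[of "snd pc"] by (cases pc) (auto simp: restrict_def)
    qed
    ultimately show "?join (?split a) = a"
      by (simp only: a_eq prod.case)
    have "boundary_spin (desc_list {c. c < C \<and> v (N, c) = Minus}) c = v (N, c)" if "c < C" for c
      using that by (cases "v (N, c)") (simp_all add: boundary_spin_desc_list)
    then show "?split a \<in> (SIGMA S:Pow {..<C}. states N C lower (desc_list S) \<times> ?G)"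
      using a by (auto simp: states_def)
  qed
  finally show ?thesis
    by (simp add: partition_function_def)
qed

lemma partition_function_0:
  "partition_function 0 C W lower upper =
    (if \<forall>c<C. boundary_spin lower c = boundary_spin upper c then 1 else 0)"
proof -
  have "states 0 C lower upper = (if \<forall>c<C. boundary_spin lower c = boundary_spin upper c
      then {(\<lambda>_. undefined, \<lambda>(p, c)\<in>{0..0} \<times> {0..<C}. boundary_spin lower c)} else {})"
    by (auto simp: states_def PiE_iff extensional_def fun_eq_iff)
  then show ?thesis
    by (simp add: partition_function_def)
qed

text \<open>A grid without rows forces equal boundaries, so only \<open>S = set lower\<close>
  survives in the decomposition.\<close>

lemma partition_function_1:
  assumes "set lower \<subseteq> {..<C}"
  shows "partition_function 1 C W lower upper =
    row_sum (W 1) (boundary_spin lower) (boundary_spin upper) C Plus"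
proof -
  have eq: "(\<forall>c<C. boundary_spin lower c = boundary_spin (desc_list S) c) \<longleftrightarrow> S = set lower"
    if "S \<subseteq> {..<C}" for S
  proof -
    have "finite S"
      using that by (rule finite_subset) simp
    then show ?thesis
      using that assms by (auto simp: boundary_spin_desc_list) (auto simp: boundary_spin_def split: if_splits)
  qed
  have "partition_function 1 C W lower upper =
      (\<Sum>S\<in>Pow {..<C}. if S = set lower
        then row_sum (W 1) (boundary_spin (desc_list S)) (boundary_spin upper) C Plus else 0)"
    unfolding One_nat_def partition_function_Suc
    by (intro sum.cong refl) (auto simp: partition_function_0 eq)
  also have "\<dots> = row_sum (W 1) (boundary_spin (desc_list (set lower))) (boundary_spin upper) C Plus"
    using assms by simp
  also have "boundary_spin (desc_list (set lower)) = boundary_spin lower"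
    by (simp add: fun_eq_iff boundary_spin_def)
  finally show ?thesis .
qed

section \<open>Free-fermionic rows\<close>

text \<open>
  A horizontal step has weight \<open>h\<close>, and the turns at the start and at the end of a horizontal
  stretch have weights \<open>u\<close> and \<open>w\<close>. In a row with \<open>+\<close> at both ends only
  \<open>u * w\<close> matters, but the two models put the factor \<open>x + y\<close> on different turns.
\<close>

fun ff_weight :: "complex \<Rightarrow> complex \<Rightarrow> complex \<Rightarrow> complex \<Rightarrow> complex \<Rightarrow> vertex_weight" where
  "ff_weight h u w A B Plus  Plus  Plus  Plus  = A"
| "ff_weight h u w A B Minus Minus Minus Minus = (u * w - h) * A * B"
| "ff_weight h u w A B Plus  Minus Plus  Minus = A * B"
| "ff_weight h u w A B Minus Plus  Minus Plus  = h * A"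
| "ff_weight h u w A B Minus Plus  Plus  Minus = u * A * B"
| "ff_weight h u w A B Plus  Minus Minus Plus  = w * A"
| "ff_weight h u w A B _ _ _ _ = 0"

text \<open>Weight of one path from column \<open>l\<close> below to column \<open>m\<close> above,
  with the factor \<open>A\<close> of every column removed: straight up, or a left turn at
  \<open>l\<close>, a horizontal run and an upward turn at \<open>m\<close>. The bracketed factor is
  the weight of a path entering column \<open>l - 1\<close> from the right.\<close>

definition ff_kernel :: "complex \<Rightarrow> complex \<Rightarrow> complex \<Rightarrow> complex \<Rightarrow> nat \<Rightarrow> nat \<Rightarrow> complex" where
  "ff_kernel h u w B l m =
    (if l = m then B else if m < l then B * u * (w * h ^ (l - Suc m)) else 0)"

text \<open>Parts decrease, so only the head can occupy the last column \<open>c\<close>; the tail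
  then fits into the first \<open>c\<close> columns.\<close>

lemma strict_partition_less_Suc_cases:
  assumes "strict_partition lam" and "set lam \<subseteq> {..<Suc c}"
  obtains "set lam \<subseteq> {..<c}"
  | lam' where "lam = c # lam'" "strict_partition lam'" "set lam' \<subseteq> {..<c}"
proof (cases lam)
  case (Cons a lam')
  then have "set lam' \<subseteq> {..<a}" "a \<le> c" "strict_partition lam'"
    using assms by (auto simp: strict_partition_def)
  then show ?thesis
    using that Cons by (cases "a = c") fastforce+
qed (use that in auto)

text \<open>
  With \<open>Minus\<close> on the right, an additional path enters there: this is the additional first row of
  the determinant.
\<close>

lemma row_sum_ff:
  fixes h u w A B
  defines "k \<equiv> ff_kernel h u w B"
  assumes "strict_partition lam" "strict_partition mu" "set lam \<subseteq> {..<c}" "set mu \<subseteq> {..<c}"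
  shows "row_sum (ff_weight h u w A B) (boundary_spin lam) (boundary_spin mu) c Plus =
      A ^ c * list_det (map k lam) mu \<and>
    row_sum (ff_weight h u w A B) (boundary_spin lam) (boundary_spin mu) c Minus =
      A ^ c * list_det ((\<lambda>m. w * h ^ (c - Suc m)) # map k lam) mu"
  using assms(2-5)
proof (induction c arbitrary: lam mu)
  case 0
  \<comment> \<open>With \<open>Minus\<close> on the right there are more rows than columns when
    \<open>mu\<close> is empty, and the determinant is 0, matching the \<open>Plus\<close> at the
    left end.\<close>
  then show ?case by (simp add: list_det_length)
next
  case (Suc c)
  let ?W = "ff_weight h u w A B"
  let ?r = "\<lambda>c m. w * h ^ (c - Suc m)"
  have bc: "boundary_spin (c # ls) c = Minus" for ls
    by (simp add: boundary_spin_def)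
  have bc': "boundary_spin ls c = Plus" if "set ls \<subseteq> {..<c}" for ls
    using that by (auto simp: boundary_spin_def)
  have bd: "boundary_spin (c # ls) d = boundary_spin ls d" if "d < c" for ls d
    using that by (simp add: boundary_spin_def)
  have drop1: "row_sum ?W (boundary_spin (c # ls)) t c a = row_sum ?W (boundary_spin ls) t c a" for ls t a
    by (rule row_sum_cong) (simp_all add: bd)
  have drop2: "row_sum ?W t (boundary_spin (c # ls)) c a = row_sum ?W t (boundary_spin ls) c a" for ls t a
    by (rule row_sum_cong) (simp_all add: bd)
  have k0: "f c = 0" if "set ls \<subseteq> {..<c}" "f \<in> set (map k ls)" for f ls
    using that by (auto simp: k_def ff_kernel_def)
  have col0: "list_det (map k ls) (c # ms) = 0" if "set ls \<subseteq> {..<c}" for ls ms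
    using k0[OF that] by (rule list_det_zero_col)
  have col1: "list_det (f # map k ls) (c # ms) = f c * list_det (map k ls) ms"
    if "set ls \<subseteq> {..<c}" for f ls ms
    using k0[OF that] by (rule list_det_Cons_Cons)
  have col2: "list_det (f # g # map k ls) (c # ms) =
      f c * list_det (g # map k ls) ms - g c * list_det (f # map k ls) ms"
    if "set ls \<subseteq> {..<c}" for f g ls ms
    using k0[OF that] by (rule list_det_Cons_Cons2)
  \<comment> \<open>A path that starts in column \<open>c\<close> and turns left looks to the
    earlier columns like one entering from the right, up to the factor \<open>B * u\<close>.\<close>
  have kc: "list_det (k c # fs) ms = B * u * list_det (?r c # fs) ms" if "set ms \<subseteq> {..<c}" for fs ms
    unfolding list_det_smult_hd[symmetric] using that
    by (intro list_det_cong_hd) (auto simp: k_def ff_kernel_def)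
  \<comment> \<open>Crossing column \<open>c\<close> adds one horizontal step, hence a factor
    \<open>h\<close>.\<close>
  have rc: "list_det ((\<lambda>m. w * h ^ (c - m)) # fs) ms = h * list_det (?r c # fs) ms" if "set ms \<subseteq> {..<c}" for fs ms
    unfolding list_det_smult_hd[symmetric] using that
    by (intro list_det_cong_hd) (auto simp: Suc_diff_Suc algebra_simps simp flip: power_Suc)
  have kcc: "k c c = B"
    by (simp add: k_def ff_kernel_def)
  from Suc.prems(1,3) show ?case
  proof (cases rule: strict_partition_less_Suc_cases)
    case 1
    note lam = Suc.prems(1) 1
    from Suc.prems(2,4) show ?thesis
    proof (cases rule: strict_partition_less_Suc_cases)
      case 1
      then show ?thesis
        using Suc.IH[OF lam(1) Suc.prems(2) lam(2) 1] lam by (simp add: bc' rc)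
    next
      case (2 mu')
      then show ?thesis
        using Suc.IH[OF lam(1) 2(2) lam(2) 2(3)] lam
        by (simp add: bc bc' drop2 col0 col1)
    qed
  next
    case (2 lam')
    note lam = this
    from Suc.prems(2,4) show ?thesis
    proof (cases rule: strict_partition_less_Suc_cases)
      case 1
      \<comment> \<open>Vertices with bottom and right \<open>Minus\<close> and top
        \<open>Plus\<close> have weight 0. Accordingly, the entering path and the path starting at
        \<open>c\<close> have proportional rows.\<close>
      have "list_det ((\<lambda>m. w * h ^ (c - m)) # k c # map k lam') mu = 0"
      proof -
        have "list_det ((\<lambda>m. w * h ^ (c - m)) # k c # map k lam') mu = h * list_det (?r c # k c # map k lam') mu"
          using 1 by (rule rc)
        also have "list_det (?r c # k c # map k lam') mu =
            list_det (?r c # (\<lambda>m. (B * u) * ?r c m) # map k lam') mu"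
          using 1 by (intro list_det_cong) (auto simp: nth_Cons k_def ff_kernel_def split: nat.split)
        also have "\<dots> = 0"
          by (rule list_det_proportional_rows)
        finally show ?thesis by simp
      qed
      then show ?thesis
        using Suc.IH[OF lam(2) Suc.prems(2) lam(3) 1] lam 1 by (simp add: bc bc' drop1 kc)
    next
      case (2 mu')
      \<comment> \<open>For right spin \<open>Minus\<close>, \<open>col2\<close> leaves the factor
        \<open>w * B * u - B * h\<close>, which is the weight of the doubly occupied vertex without
        \<open>A\<close>: the free-fermionic relation enters here.\<close>
      then show ?thesis
        using Suc.IH[OF lam(2) 2(2) lam(3) 2(3)] lam
        by (simp add: bc bc' drop1 drop2 col1 col2 kc rc kcc algebra_simps)
    qed
  qed
qed

section \<open>Composition of the rows\<close>

text \<open>One path through \<open>N\<close> rows. The bound \<open>max l m\<close>, in place of a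
  number of columns, gives one kernel for grids of all widths.\<close>

fun iter_kernel :: "(nat \<Rightarrow> nat \<Rightarrow> nat \<Rightarrow> complex) \<Rightarrow> nat \<Rightarrow> nat \<Rightarrow> nat \<Rightarrow> complex" where
  "iter_kernel K 0 l m = (if l = m then 1 else 0)"
| "iter_kernel K (Suc N) l m = (\<Sum>n\<le>max l m. iter_kernel K N l n * K (Suc N) n m)"

text \<open>
  Paths move in one horizontal direction only, to the left in one model and to the right in the
  other. This makes the sum over the intermediate position independent of the number of columns.
\<close>

definition triangular :: "(nat \<Rightarrow> nat \<Rightarrow> nat \<Rightarrow> complex) \<Rightarrow> bool" where
  "triangular K \<longleftrightarrow> (\<forall>p n m. n < m \<longrightarrow> K p n m = 0) \<or> (\<forall>p n m. m < n \<longrightarrow> K p n m = 0)"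

lemma iter_kernel_lower:
  assumes "\<And>p n m. n < m \<Longrightarrow> K p n m = 0" and "l < m"
  shows "iter_kernel K N l m = 0"
  using assms(2)
proof (induction N arbitrary: m)
  case (Suc N)
  have "iter_kernel K N l n * K (Suc N) n m = 0" for n
    using Suc assms(1)[of n m "Suc N"] by (cases "l < n") auto
  then show ?case
    by (simp only: iter_kernel.simps sum.neutral_const)
qed simp

text \<open>For \<open>n\<close> beyond \<open>max l m\<close>, a left-moving path cannot reach
  \<open>n\<close> from \<open>l\<close> and a right-moving one cannot return from \<open>n\<close>
  to \<open>m\<close>, so one of the two factors vanishes.\<close>

lemma iter_kernel_Suc_lessThan:
  assumes "triangular K" and "l < C" "m < C"
  shows "(\<Sum>n<C. iter_kernel K N l n * K (Suc N) n m) = iter_kernel K (Suc N) l m"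
proof -
  have "iter_kernel K N l n * K (Suc N) n m = 0" if "n \<in> {..<C} - {..max l m}" for n
    using assms(1) iter_kernel_lower[of K l n N] that by (auto simp: triangular_def)
  then show ?thesis
    using assms(2,3) unfolding iter_kernel.simps
    by (intro sum.mono_neutral_right ballI) auto
qed

text \<open>Rows are added from the bottom up: Cauchy-Binet turns the sum over the spins between two
  rows into composition of kernels, and the scalars \<open>a p\<close> multiply.\<close>

lemma partition_function_eq_list_det:
  assumes "triangular K"
    and row: "\<And>p c S T. strict_partition S \<Longrightarrow> strict_partition T \<Longrightarrow> set S \<subseteq> {..<c} \<Longrightarrow> set T \<subseteq> {..<c} \<Longrightarrow>
      row_sum (W p) (boundary_spin S) (boundary_spin T) c Plus = a p ^ c * list_det (map (K p) S) T"
    and "N \<ge> 1" and lower: "strict_partition lower" "set lower \<subseteq> {..<C}"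
    and "strict_partition upper" "set upper \<subseteq> {..<C}"
  shows "partition_function N C W lower upper =
    (\<Prod>p=1..N. a p) ^ C * list_det (map (iter_kernel K N) lower) upper"
  using assms(3,6,7)
proof (induction N arbitrary: upper rule: nat_induct_at_least)
  case base
  have "iter_kernel K 1 l m = K 1 l m" for l m
  proof -
    have "(if l = n then 1 else 0) * K 1 n m = (if l = n then K 1 n m else 0)" for n
      by simp
    then show ?thesis by simp
  qed
  then have "iter_kernel K 1 = K 1"
    by (simp add: fun_eq_iff)
  then show ?case
    using row[OF lower(1) base(1) lower(2) base(2), of 1] partition_function_1[OF lower(2)]
    by simp
next
  case (Suc N)
  let ?a = "\<Prod>p=1..N. a p"
  let ?z = "iter_kernel K N"
  have "partition_function (Suc N) C W lower upper = (\<Sum>S\<in>Pow {..<C}.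
      (?a * a (Suc N)) ^ C * (list_det (map ?z lower) (desc_list S) * list_det (map (K (Suc N)) (desc_list S)) upper))"
    unfolding partition_function_Suc
  proof (intro sum.cong refl)
    fix S assume "S \<in> Pow {..<C}"
    then have "set (desc_list S) \<subseteq> {..<C}"
      by (metis PowD finite_lessThan finite_subset set_desc_list)
    then show "partition_function N C W lower (desc_list S) *
        row_sum (W (Suc N)) (boundary_spin (desc_list S)) (boundary_spin upper) C Plus =
      (?a * a (Suc N)) ^ C * (list_det (map ?z lower) (desc_list S) * list_det (map (K (Suc N)) (desc_list S)) upper)"
      using Suc.IH[of "desc_list S"] row[of "desc_list S" upper C "Suc N"] Suc.prems
      by (simp add: power_mult_distrib)
  qed
  also have "\<dots> = (?a * a (Suc N)) ^ C *
      list_det (map (\<lambda>l m. \<Sum>n<C. ?z l n * K (Suc N) n m) lower) upper"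
    using cauchy_binet[where fs = "map ?z lower" and g = "K (Suc N)" and ms = upper and C = C]
    by (simp add: comp_def flip: sum_distrib_left)
  also have "list_det (map (\<lambda>l m. \<Sum>n<C. ?z l n * K (Suc N) n m) lower) upper =
      list_det (map (iter_kernel K (Suc N)) lower) upper"
  proof (rule list_det_cong)
    fix i m assume "i < length (map (\<lambda>l m. \<Sum>n<C. ?z l n * K (Suc N) n m) lower)" "m \<in> set upper"
    then have "i < length lower" "lower ! i < C" "m < C"
      using lower Suc.prems by (auto simp: subset_iff)
    then show "(map (\<lambda>l m. \<Sum>n<C. ?z l n * K (Suc N) n m) lower ! i) m =
        (map (iter_kernel K (Suc N)) lower ! i) m"
      using iter_kernel_Suc_lessThan[OF assms(1)] by (simp del: iter_kernel.simps)
  qed simp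
  finally show ?case
    by (simp del: iter_kernel.simps)
qed

text \<open>The Leibniz term of \<open>p\<close> carries \<open>a\<close> to the power of the sum of
  \<open>Cs i (p i)\<close>, which is \<open>C\<close> for every \<open>p\<close>; so the scalar
  factors out although the entries have different exponents.\<close>

lemma det_scaled_kernel:
  assumes "length lam = l" "length mu = l"
    and C: "\<And>\<sigma>. \<sigma> permutes {..<l} \<Longrightarrow> C = (\<Sum>i<l. Cs i (\<sigma> i))"
    and F: "\<And>i j. i < l \<Longrightarrow> j < l \<Longrightarrow> F i j = a ^ Cs i j * f (lam ! i) (mu ! j)"
  shows "det (mat l l (\<lambda>(i, j). F i j)) = a ^ C * list_det (map f lam) mu"
proof -
  have "det (mat l l (\<lambda>(i, j). F i j)) =
      (\<Sum>p | p permutes {0..<l}. signof p * (\<Prod>i = 0..<l. F i (p i)))"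
    by (auto simp: det_def intro!: sum.cong prod.cong dest: permutes_in_image)
  also have "\<dots> = (\<Sum>p | p permutes {0..<l}. a ^ C * (signof p * (\<Prod>i = 0..<l. f (lam ! i) (mu ! p i))))"
  proof (intro sum.cong refl)
    fix p assume "p \<in> {p. p permutes {0..<l}}"
    then have p: "p permutes {0..<l}" by simp
    have "(\<Prod>i = 0..<l. F i (p i)) = (\<Prod>i = 0..<l. a ^ Cs i (p i) * f (lam ! i) (mu ! p i))"
      using F permutes_in_image[OF p] by (intro prod.cong) auto
    also have "\<dots> = a ^ C * (\<Prod>i = 0..<l. f (lam ! i) (mu ! p i))"
      using C[of p] p by (simp add: prod.distrib power_sum lessThan_atLeast0)
    finally show "signof p * (\<Prod>i = 0..<l. F i (p i)) =
        a ^ C * (signof p * (\<Prod>i = 0..<l. f (lam ! i) (mu ! p i)))"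
      by (simp add: algebra_simps)
  qed
  also have "\<dots> = a ^ C * list_det (map f lam) mu"
    using assms(1,2) by (subst list_det_leibniz[of _ l]) (simp_all add: sum_distrib_left)
  finally show ?thesis .
qed

section \<open>The two models as free-fermionic rows\<close>

lemma weight_S_eq_ff_weight: "weight_S x y A B = ff_weight x (x + y) 1 A B"
proof (intro ext)
  fix l t r b
  show "weight_S x y A B l t r b = ff_weight x (x + y) 1 A B l t r b"
    by (cases l; cases t; cases r; cases b) simp_all
qed

text \<open>Here \<open>u * w - h\<close> equals \<open>x\<close>, as it equals \<open>y\<close> in
  the first model. The argument order \<open>l b r t\<close> turns the row upside down.\<close>

lemma weight_S_star_eq_ff_weight:
  "weight_S_star x y A B = (\<lambda>l t r b. ff_weight y 1 (x + y) (inverse A) (inverse B) l b r t)"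
proof (intro ext)
  fix l t r b
  show "weight_S_star x y A B l t r b = ff_weight y 1 (x + y) (inverse A) (inverse B) l b r t"
    by (cases l; cases t; cases r; cases b) simp_all
qed

theorem proposition5p4:
  fixes N C l :: nat
    and x y A B :: "nat \<Rightarrow> complex"
    and lam mu :: "nat list"
    and Cs :: "nat \<Rightarrow> nat \<Rightarrow> nat"
  assumes "N \<ge> 1"
    and "\<And>i. i \<in> {1..N} \<Longrightarrow> A i \<noteq> 0 \<and> B i \<noteq> 0"
    and "strict_partition lam" and "strict_partition mu"
    and "length lam = l" and "length mu = l"
    and "\<And>k. k \<in> set lam \<union> set mu \<Longrightarrow> k < C"
    and "\<And>i j. i < l \<Longrightarrow> j < l \<Longrightarrow> lam ! i < Cs i j \<and> mu ! j < Cs i j"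
    and "\<And>\<sigma>. \<sigma> permutes {..<l} \<Longrightarrow> C = (\<Sum>i<l. Cs i (\<sigma> i))"
  shows "Z_S N C x y A B lam mu =
           det (mat l l (\<lambda>(i, j). Z_S N (Cs i j) x y A B [lam ! i] [mu ! j])) \<and>
         Z_S_star N C x y A B lam mu =
           det (mat l l (\<lambda>(i, j). Z_S_star N (Cs i j) x y A B [lam ! i] [mu ! j]))"
proof
  have lam: "set lam \<subseteq> {..<C}" and mu: "set mu \<subseteq> {..<C}"
    using assms(7) by auto
  have single: "strict_partition [n]" for n
    by (simp add: strict_partition_def)
  show "Z_S N C x y A B lam mu =
      det (mat l l (\<lambda>(i, j). Z_S N (Cs i j) x y A B [lam ! i] [mu ! j]))"
  proof -
    define K where "K p = ff_kernel (x p) (x p + y p) 1 (B p)" for p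
    have tri: "triangular K"
      by (simp add: triangular_def K_def ff_kernel_def)
    have row: "row_sum (ff_weight (x p) (x p + y p) 1 (A p) (B p)) (boundary_spin S) (boundary_spin T) c Plus =
        A p ^ c * list_det (map (K p) S) T"
      if "strict_partition S" "strict_partition T" "set S \<subseteq> {..<c}" "set T \<subseteq> {..<c}" for p c S T
      unfolding K_def using row_sum_ff[OF that] by blast
    have Z: "Z_S N c x y A B S T = (\<Prod>p=1..N. A p) ^ c * list_det (map (iter_kernel K N) S) T"
      if "strict_partition S" "strict_partition T" "set S \<subseteq> {..<c}" "set T \<subseteq> {..<c}" for c S T
      unfolding Z_S_def weight_S_eq_ff_weight
      by (rule partition_function_eq_list_det[OF tri row assms(1) that(1,3,2,4)])
    have "det (mat l l (\<lambda>(i, j). Z_S N (Cs i j) x y A B [lam ! i] [mu ! j])) =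
        (\<Prod>p=1..N. A p) ^ C * list_det (map (iter_kernel K N) lam) mu"
    proof (rule det_scaled_kernel[OF assms(5,6,9)])
      fix j k assume "j < l" "k < l"
      then show "Z_S N (Cs j k) x y A B [lam ! j] [mu ! k] =
          (\<Prod>p=1..N. A p) ^ Cs j k * iter_kernel K N (lam ! j) (mu ! k)"
        using Z[of "[lam ! j]" "[mu ! k]" "Cs j k"] assms(8)[of j k] single
        by (simp add: list_det_singleton)
    qed
    then show ?thesis
      using Z[OF assms(3,4) lam mu] by simp
  qed
  show "Z_S_star N C x y A B lam mu =
      det (mat l l (\<lambda>(i, j). Z_S_star N (Cs i j) x y A B [lam ! i] [mu ! j]))"
  proof -
    define i where "i p = N + 1 - p" for p
    \<comment> \<open>The arguments are swapped: rows are composed from bottom to top, whereas the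
      kernel of a row turned upside down starts at its top edge.\<close>
    define K where "K p m n = ff_kernel (y (i p)) 1 (x (i p) + y (i p)) (inverse (B (i p))) n m" for p m n
    have tri: "triangular K"
      by (simp add: triangular_def K_def ff_kernel_def)
    have row: "row_sum (\<lambda>l t r b. ff_weight (y (i p)) 1 (x (i p) + y (i p)) (inverse (A (i p)))
          (inverse (B (i p))) l b r t) (boundary_spin S) (boundary_spin T) c Plus =
        inverse (A (i p)) ^ c * list_det (map (K p) S) T"
      if "strict_partition S" "strict_partition T" "set S \<subseteq> {..<c}" "set T \<subseteq> {..<c}" for p c S T
    proof -
      have "list_det (map (ff_kernel (y (i p)) 1 (x (i p) + y (i p)) (inverse (B (i p)))) T) S =
          list_det (map (K p) S) T"
        unfolding K_def[abs_def] by (rule list_det_transpose)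
      then show ?thesis
        using row_sum_ff[OF that(2,1,4,3)] by (subst row_sum_flip) metis
    qed
    \<comment> \<open>Transposing once more lets the parts on the top boundary index the rows, as
      those of \<open>lam\<close> do in the claim.\<close>
    have Z: "Z_S_star N c x y A B T S =
        (\<Prod>p=1..N. inverse (A (i p))) ^ c * list_det (map (\<lambda>m n. iter_kernel K N n m) T) S"
      if "strict_partition S" "strict_partition T" "set S \<subseteq> {..<c}" "set T \<subseteq> {..<c}" for c S T
    proof -
      have "Z_S_star N c x y A B T S =
          (\<Prod>p=1..N. inverse (A (i p))) ^ c * list_det (map (iter_kernel K N) S) T"
        unfolding Z_S_star_def weight_S_star_eq_ff_weight Let_def i_def[symmetric]
        by (rule partition_function_eq_list_det[OF tri row assms(1) that(1,3,2,4)])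
      then show ?thesis
        by (simp only: list_det_transpose[of "iter_kernel K N" S])
    qed
    have "det (mat l l (\<lambda>(i, j). Z_S_star N (Cs i j) x y A B [lam ! i] [mu ! j])) =
        (\<Prod>p=1..N. inverse (A (i p))) ^ C * list_det (map (\<lambda>m n. iter_kernel K N n m) lam) mu"
    proof (rule det_scaled_kernel[OF assms(5,6,9)])
      fix j k assume "j < l" "k < l"
      then show "Z_S_star N (Cs j k) x y A B [lam ! j] [mu ! k] =
          (\<Prod>p=1..N. inverse (A (i p))) ^ Cs j k * iter_kernel K N (mu ! k) (lam ! j)"
        using Z[of "[mu ! k]" "[lam ! j]" "Cs j k"] assms(8)[of j k] single
        by (simp add: list_det_singleton)
    qed
    then show ?thesis
      using Z[OF assms(4,3) mu lam] by simp
  qed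
qed

end
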